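(* Let $A$ be a non-empty bounded subset of an $L$-embedded Banach space $X$. Then there is a point in $X$ fixed by every weakly continuous isometry $s$ of $X$ into $X$ preserving $A$ (i.e. with $s(A)=A$). Moreover, one can choose a fixed point which minimizes $\sup_{a\in A}\|x-a\|$ over all $x\in X$.
   Context: An isometry of $X$ into $X$ is a map $s:X\to X$ with $\|sx-sy\|=\|x-y\|$ for all $x,y\in X$ (not assumed linear, affine or surjective). Weakly continuous means continuous from $X$ with the weak topology to $X$ with the weak topology. A Banach space $X$ is $L$-embedded if its bidual can be decomposed as $X^{**}=X\oplus_1X_s$ for some subspace $X_s\subset X^{**}$, i.e. $X^{**}$ is the direct sum of (the canonical image of) $X$ and $X_s$, and $\|x+\xi\|=\|x\|+\|\xi\|$ for $x\in X$, $\xi\in X_s$. *)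

theory Defs
  imports "HOL-Analysis.Analysis"
begin

text \<open>The type class \<open>banach\<close> is that of real Banach spaces. A complex Banach space becomes one by
  restriction of scalars. Taking real parts identifies its complex dual isometrically with its real
  dual, so the weak topology and the canonical decomposition of the bidual are preserved.\<close>

definition canonical_embedding ::
    "'a::real_normed_vector \<Rightarrow> (('a \<Rightarrow>\<^sub>L real) \<Rightarrow>\<^sub>L real)" where
  "canonical_embedding x = Blinfun (\<lambda>f. blinfun_apply f x)"

text \<open>\<open>Blinfun\<close> is unspecified on maps that are not bounded linear; here it always applies to a
  bounded linear map:\<close>

lemma canonical_embedding_apply [simp]:
  "blinfun_apply (canonical_embedding x) f = blinfun_apply f x"
  unfolding canonical_embedding_def
  by (simp add: bounded_linear_Blinfun_apply blinfun.bounded_linear_left)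

definition L_embedded :: "'a::banach itself \<Rightarrow> bool" where
  "L_embedded _ \<longleftrightarrow>
    (\<exists>Xs :: (('a \<Rightarrow>\<^sub>L real) \<Rightarrow>\<^sub>L real) set.
       subspace Xs \<and>
       range canonical_embedding \<inter> Xs = {0} \<and>
       (\<forall>\<Phi>. \<exists>x. \<exists>\<xi>\<in>Xs. \<Phi> = canonical_embedding x + \<xi>) \<and>
       (\<forall>x. \<forall>\<xi>\<in>Xs. norm (canonical_embedding x + \<xi>) = norm x + norm \<xi>))"

text \<open>The coarsest topology making every bounded linear functional continuous: on the function type
  \<open>('a \<Rightarrow>\<^sub>L real) \<Rightarrow> real\<close>, \<open>euclidean\<close> is the product topology.\<close>

definition weak_topology :: "'a::real_normed_vector topology" where
  "weak_topology =
    pullback_topology UNIV (\<lambda>x (f :: 'a \<Rightarrow>\<^sub>L real). blinfun_apply f x) euclidean"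

end

theory Submission
  imports Defs
begin

text \<open>
The fixed point is found among the Chebyshev centres of \<open>A\<close>, the points minimizing the largest
distance to \<open>A\<close>. They form a convex set, and a weakly continuous isometry that maps \<open>A\<close> onto itself
maps this set into itself.

In the bidual the set of Chebyshev centres of \<open>A\<close> is nonempty and weak star compact. In an
\<open>L\<close>-embedded space the part of a bidual element in the complement of \<open>X\<close> only increases its distance
to points of \<open>A\<close>, by its norm. Hence all centres in the bidual lie in \<open>X\<close>
(\<open>bidual_centers_L_embedded\<close>), and as the weak star topology of the bidual induces the weak topology
on \<open>X\<close>, the Chebyshev centres form a nonempty weakly compact convex set.

It remains to prove that a family of weakly continuous isometries mapping a weakly compact convex
set into itself has a common fixed point there, a nonlinear version of the Ryll-Nardzewski theorem
(\<open>nonlinear_Ryll_Nardzewski\<close>). Since sets of fixed points are weakly closed, finite families suffice.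
For these, minimal invariant weakly closed sets are norm compact, by an argument in the spirit of
Namioka (\<open>minimal_invariant_compact\<close>): Baire's theorem provides one weakly open piece of small
diameter, minimality spreads it over the whole set, and the isometries preserve its diameter.
Isometries then act on a minimal set by surjections (\<open>compact_isometry_surj\<close>), and since convex hulls of
norm compact sets contain points that see the set under a radius smaller than its diameter
(\<open>compact_normal_structure\<close>), a minimal set inside a minimal convex invariant set must be a single
point, which is the fixed point.

The weak topology enters through three consequences of the Hahn-Banach theorem: it is Hausdorff,
and norm closed balls and norm closed subspaces are weakly closed.
\<close>

section \<open>Sublinear functionals and the Hahn-Banach theorem\<close>

definition sublinear :: "('a::real_vector \<Rightarrow> real) \<Rightarrow> bool" where
  "sublinear p \<longleftrightarrow> (\<forall>x y. p (x + y) \<le> p x + p y) \<and> (\<forall>c x. c \<ge> 0 \<longrightarrow> p (c *\<^sub>R x) = c * p x)"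

lemma sublinear_add: "sublinear p \<Longrightarrow> p (x + y) \<le> p x + p y"
  by (simp add: sublinear_def)

lemma sublinear_scaleR: "sublinear p \<Longrightarrow> c \<ge> 0 \<Longrightarrow> p (c *\<^sub>R x) = c * p x"
  by (simp add: sublinear_def)

lemma sublinear_zero: "sublinear p \<Longrightarrow> p 0 = 0"
  using sublinear_scaleR[of p 0 0] by simp

lemma sublinear_diff: "sublinear p \<Longrightarrow> p x - p (- y) \<le> p (x + y)"
  using sublinear_add[of p "x + y" "- y"] by simp

lemma sublinearI:
  assumes add: "\<And>x y. p (x + y) \<le> p x + p y"
    and zero: "p 0 = 0"
    and scale: "\<And>c x. c > 0 \<Longrightarrow> p (c *\<^sub>R x) \<le> c * p x"
  shows "sublinear p"
  unfolding sublinear_def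
proof (intro conjI allI impI add)
  fix c :: real and x assume "c \<ge> 0"
  show "p (c *\<^sub>R x) = c * p x"
  proof (cases "c = 0")
    case False
    then have "c > 0" using \<open>c \<ge> 0\<close> by simp
    have "p x \<le> inverse c * p (c *\<^sub>R x)"
      using scale[of "inverse c" "c *\<^sub>R x"] \<open>c > 0\<close> by simp
    then have "c * p x \<le> p (c *\<^sub>R x)"
      using \<open>c > 0\<close> by (simp add: field_simps)
    then show ?thesis
      using scale[OF \<open>c > 0\<close>] by (simp add: antisym)
  qed (simp add: zero)
qed

text \<open>The largest sublinear functional below \<open>p\<close> that agrees with \<open>p\<close> at \<open>a\<close> and is additive along the ray
spanned by \<open>a\<close>. A minimal sublinear functional is unchanged by this operation for every \<open>a\<close>, which
forces it to be linear.\<close>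

definition linearize_along :: "'a::real_vector \<Rightarrow> ('a \<Rightarrow> real) \<Rightarrow> 'a \<Rightarrow> real" where
  "linearize_along a p x = (INF t\<in>{0..}. p (x + t *\<^sub>R a) - t * p a)"

lemma linearize_along_le:
  assumes "sublinear p" "t \<ge> 0"
  shows "linearize_along a p x \<le> p (x + t *\<^sub>R a) - t * p a"
  unfolding linearize_along_def
proof (rule cINF_lower)
  have "- p (- x) \<le> p (x + t *\<^sub>R a) - t * p a" if "t \<ge> 0" for t
    using sublinear_diff[OF assms(1), of "t *\<^sub>R a" x] sublinear_scaleR[OF assms(1) that]
    by (simp add: add.commute)
  then show "bdd_below ((\<lambda>t. p (x + t *\<^sub>R a) - t * p a) ` {0..})"
    by (auto intro!: bdd_belowI2)
qed (use assms in auto)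

lemma linearize_along_greatest:
  assumes "\<And>t. t \<ge> 0 \<Longrightarrow> m \<le> p (x + t *\<^sub>R a) - t * p a"
  shows "m \<le> linearize_along a p x"
  unfolding linearize_along_def by (rule cINF_greatest) (use assms in auto)

lemma linearize_along_le_self: "sublinear p \<Longrightarrow> linearize_along a p x \<le> p x"
  using linearize_along_le[of p 0 a x] by simp

lemma sublinear_linearize_along:
  assumes "sublinear p"
  shows "sublinear (linearize_along a p)"
proof (rule sublinearI)
  fix x y
  \<comment> \<open>At \<open>x + y\<close> use the parameter \<open>t + s\<close> and split it between \<open>x\<close> and \<open>y\<close>; then take the infimum over \<open>t\<close>, then over \<open>s\<close>.\<close>
  have "linearize_along a p (x + y) - (p (y + s *\<^sub>R a) - s * p a) \<le> p (x + t *\<^sub>R a) - t * p a"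
    if "s \<ge> 0" "t \<ge> 0" for s t
  proof -
    have "linearize_along a p (x + y) \<le> p ((x + t *\<^sub>R a) + (y + s *\<^sub>R a)) - (t + s) * p a"
      using linearize_along_le[OF assms, of "t + s" a "x + y"] that
      by (simp add: scaleR_add_left add_ac)
    then show ?thesis
      using sublinear_add[OF assms, of "x + t *\<^sub>R a" "y + s *\<^sub>R a"] by (simp add: algebra_simps)
  qed
  then have "linearize_along a p (x + y) - (p (y + s *\<^sub>R a) - s * p a) \<le> linearize_along a p x"
    if "s \<ge> 0" for s
    by (rule linearize_along_greatest) (use that in auto)
  then have "linearize_along a p (x + y) - linearize_along a p x \<le> p (y + s *\<^sub>R a) - s * p a"
    if "s \<ge> 0" for s
    using that by (simp add: algebra_simps)
  then have "linearize_along a p (x + y) - linearize_along a p x \<le> linearize_along a p y"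
    by (rule linearize_along_greatest)
  then show "linearize_along a p (x + y) \<le> linearize_along a p x + linearize_along a p y"
    by simp
next
  show "linearize_along a p 0 = 0"
    by (simp add: linearize_along_def sublinear_scaleR[OF assms])
next
  fix c :: real and x assume "c > 0"
  have "linearize_along a p (c *\<^sub>R x) / c \<le> p (x + t *\<^sub>R a) - t * p a" if "t \<ge> 0" for t
  proof -
    have "linearize_along a p (c *\<^sub>R x) \<le> p (c *\<^sub>R (x + t *\<^sub>R a)) - (c * t) * p a"
      using linearize_along_le[OF assms, of "c * t" a "c *\<^sub>R x"] that \<open>c > 0\<close>
      by (simp add: scaleR_add_right)
    also have "\<dots> = c * (p (x + t *\<^sub>R a) - t * p a)"
      using sublinear_scaleR[OF assms, of c "x + t *\<^sub>R a"] \<open>c > 0\<close> by (simp add: algebra_simps)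
    finally show ?thesis
      using \<open>c > 0\<close> by (simp add: field_simps)
  qed
  then have "linearize_along a p (c *\<^sub>R x) / c \<le> linearize_along a p x"
    by (rule linearize_along_greatest)
  then show "linearize_along a p (c *\<^sub>R x) \<le> c * linearize_along a p x"
    using \<open>c > 0\<close> by (simp add: field_simps)
qed

text \<open>Zorn's lemma: the pointwise infimum of a chain of sublinear functionals is sublinear, because of two
comparable members the smaller one serves for both summands, and it is finite, because every
sublinear \<open>q \<le> p\<close> satisfies \<open>- p (- x) \<le> q x\<close>.\<close>

lemma exists_minimal_sublinear_below:
  assumes "sublinear p"
  obtains q where "sublinear q" "\<And>x. q x \<le> p x"
    "\<And>r. sublinear r \<Longrightarrow> (\<And>x. r x \<le> q x) \<Longrightarrow> r = q"
proof -
  define A where "A = {q. sublinear q \<and> (\<forall>x. q x \<le> p x)}"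
  define R :: "('a \<Rightarrow> real) \<Rightarrow> ('a \<Rightarrow> real) \<Rightarrow> bool" where "R q r \<longleftrightarrow> (\<forall>x. r x \<le> q x)" for q r
  have bound: "- p (- x) \<le> q x" if "q \<in> A" for q x
  proof -
    have "- q (- x) \<le> q x"
      using that sublinear_add[of q x "- x"] sublinear_zero[of q] by (auto simp: A_def)
    moreover have "q (- x) \<le> p (- x)"
      using that by (simp add: A_def)
    ultimately show ?thesis by simp
  qed
  have "\<exists>m\<in>A. \<forall>a\<in>A. R m a \<longrightarrow> a = m"
  proof (rule predicate_Zorn)
    show "partial_order_on A (relation_of R A)"
      by (rule partial_order_on_relation_ofI) (auto simp: R_def fun_eq_iff intro: order_trans antisym)
  next
    fix C assume C: "C \<in> Chains (relation_of R A)"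
    then have CA: "C \<subseteq> A"
      by (auto simp: Chains_def relation_of_def)
    have total: "R q r \<or> R r q" if "q \<in> C" "r \<in> C" for q r
      using C that by (auto simp: Chains_def relation_of_def)
    show "\<exists>u\<in>A. \<forall>a\<in>C. R a u"
    proof (cases "C = {}")
      case True
      then show ?thesis
        using assms by (auto simp: A_def)
    next
      case False
      define u where "u x = (INF q\<in>C. q x)" for x
      have le: "u x \<le> q x" if "q \<in> C" for q x
        unfolding u_def
        by (rule cINF_lower) (use bound CA that in \<open>auto intro!: bdd_belowI2\<close>)
      have ge: "m \<le> u x" if "\<And>q. q \<in> C \<Longrightarrow> m \<le> q x" for m x
        unfolding u_def by (rule cINF_greatest) (use False that in auto)
      have sub: "sublinear q" if "q \<in> C" for q
        using CA that by (auto simp: A_def)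
      have "sublinear u"
      proof (rule sublinearI)
        fix x y
        have "u (x + y) - r y \<le> q x" if "q \<in> C" "r \<in> C" for q r
        proof -
          have "u (x + y) \<le> q x + q y" "u (x + y) \<le> r x + r y"
            using le[OF that(1), of "x + y"] sublinear_add[OF sub[OF that(1)], of x y]
              le[OF that(2), of "x + y"] sublinear_add[OF sub[OF that(2)], of x y] by auto
          moreover have "q y \<le> r y \<or> r x \<le> q x"
            using total[OF that] by (auto simp: R_def)
          ultimately show ?thesis by auto
        qed
        then have "u (x + y) - r y \<le> u x" if "r \<in> C" for r
          using that by (intro ge)
        then have "u (x + y) - u x \<le> u y"
          by (intro ge) (simp add: algebra_simps)
        then show "u (x + y) \<le> u x + u y" by simp
      next
        show "u 0 = 0"
          using False sub by (simp add: u_def sublinear_zero cong: INF_cong)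
      next
        fix c :: real and x assume "c > 0"
        have "u (c *\<^sub>R x) / c \<le> q x" if "q \<in> C" for q
          using le[OF that, of "c *\<^sub>R x"] sublinear_scaleR[OF sub[OF that], of c x] \<open>c > 0\<close>
          by (simp add: field_simps)
        then have "u (c *\<^sub>R x) / c \<le> u x" by (rule ge)
        then show "u (c *\<^sub>R x) \<le> c * u x"
          using \<open>c > 0\<close> by (simp add: field_simps)
      qed
      moreover have "u x \<le> p x" for x
      proof -
        obtain q where "q \<in> C" using False by blast
        then have "u x \<le> q x" "q x \<le> p x"
          using le CA by (auto simp: A_def)
        then show ?thesis by simp
      qed
      ultimately show ?thesis
        using le by (auto simp: A_def R_def)
    qed
  qed
  then obtain m where m: "m \<in> A" "\<And>a. a \<in> A \<Longrightarrow> R m a \<Longrightarrow> a = m" by blast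
  show thesis
  proof (rule that)
    fix r assume "sublinear r" "\<And>x. r x \<le> m x"
    moreover from this have "r x \<le> p x" for x
      using m(1) order_trans[of "r x" "m x" "p x"] by (simp add: A_def)
    ultimately show "r = m"
      by (intro m) (auto simp: A_def R_def)
  qed (use m in \<open>auto simp: A_def\<close>)
qed

text \<open>A minimal sublinear functional below \<open>p\<close> is linear. Starting the descent from
\<open>linearize_along a p\<close> rather than from \<open>p\<close> gives \<open>q (- a) \<le> - p a\<close>, so that the linear functional
attains the value \<open>p a\<close> at \<open>a\<close>.\<close>

theorem Hahn_Banach_sublinear:
  assumes "sublinear p"
  obtains f where "linear f" "\<And>x. f x \<le> p x" "f a = p a"
proof -
  obtain q where q: "sublinear q" "\<And>x. q x \<le> linearize_along a p x"
    and minimal: "\<And>r. sublinear r \<Longrightarrow> (\<And>x. r x \<le> q x) \<Longrightarrow> r = q"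
    using exists_minimal_sublinear_below[OF sublinear_linearize_along[OF assms]] by blast
  have add: "q (x + y) = q x + q y" for x y
  proof -
    have "linearize_along y q = q"
      using q(1) by (intro minimal sublinear_linearize_along linearize_along_le_self)
    then have "q x \<le> q (x + y) - q y"
      using linearize_along_le[OF q(1), of 1 y x] by simp
    then show ?thesis
      using sublinear_add[OF q(1), of x y] by simp
  qed
  have neg: "q (- x) = - q x" for x
    using add[of x "- x"] sublinear_zero[OF q(1)] by simp
  have "linear q"
  proof (rule linearI)
    show "q (c *\<^sub>R x) = c *\<^sub>R q x" for c x
      using sublinear_scaleR[OF q(1), of c x] sublinear_scaleR[OF q(1), of "- c" x] neg[of "c *\<^sub>R x"]
      by (cases "c \<ge> 0") auto
  qed (rule add)
  moreover have below: "q x \<le> p x" for x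
    using q(2) linearize_along_le_self[OF assms] order_trans by blast
  moreover have "q a = p a"
  proof -
    have "q (- a) \<le> - p a"
      using q(2)[of "- a"] linearize_along_le[OF assms, of 1 a "- a"] sublinear_zero[OF assms]
      by simp
    then show ?thesis
      using neg[of a] below[of a] by simp
  qed
  ultimately show thesis by (rule that)
qed

section \<open>Functionals dominated by the distance to a subspace\<close>

lemma infdist_subspace_approx:
  fixes V :: "'a::real_normed_vector set"
  assumes "subspace V" "e > 0"
  obtains v where "v \<in> V" "norm (x - v) < infdist x V + e"
proof -
  have "V \<noteq> {}"
    using subspace_0[OF assms(1)] by blast
  moreover have "bdd_below (dist x ` V)"
    by (auto intro!: bdd_belowI2[where m = 0])
  moreover have "(INF v\<in>V. dist x v) < infdist x V + e"
    using \<open>V \<noteq> {}\<close> assms(2) by (simp add: infdist_def)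
  ultimately show thesis
    using that by (auto simp: cINF_less_iff dist_norm)
qed

lemma sublinear_infdist:
  fixes V :: "'a::real_normed_vector set"
  assumes "subspace V"
  shows "sublinear (\<lambda>x. infdist x V)"
proof (rule sublinearI)
  fix x y
  show "infdist (x + y) V \<le> infdist x V + infdist y V"
  proof (rule field_le_epsilon)
    fix e :: real assume "e > 0"
    then obtain u v where uv: "u \<in> V" "norm (x - u) < infdist x V + e / 2"
      "v \<in> V" "norm (y - v) < infdist y V + e / 2"
      using infdist_subspace_approx[OF assms, of "e / 2"] by (metis half_gt_zero)
    have "infdist (x + y) V \<le> norm ((x + y) - (u + v))"
      using infdist_le[of "u + v" V "x + y"] uv subspace_add[OF assms] by (simp add: dist_norm)
    also have "\<dots> \<le> norm (x - u) + norm (y - v)"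
      by (simp add: norm_diff_triangle_ineq)
    finally show "infdist (x + y) V \<le> infdist x V + infdist y V + e"
      using uv by simp
  qed
next
  show "infdist 0 V = 0"
    using subspace_0[OF assms] by simp
next
  fix c :: real and x assume "c > 0"
  show "infdist (c *\<^sub>R x) V \<le> c * infdist x V"
  proof (rule field_le_epsilon)
    fix e :: real assume "e > 0"
    then obtain v where v: "v \<in> V" "norm (x - v) < infdist x V + e / c"
      using infdist_subspace_approx[OF assms, of "e / c"] \<open>c > 0\<close> by (metis divide_pos_pos)
    have "infdist (c *\<^sub>R x) V \<le> norm (c *\<^sub>R (x - v))"
      using infdist_le[of "c *\<^sub>R v" V "c *\<^sub>R x"] v subspace_scale[OF assms]
      by (simp add: dist_norm scaleR_diff_right)
    also have "\<dots> = c * norm (x - v)"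
      using \<open>c > 0\<close> by simp
    also have "\<dots> \<le> c * infdist x V + e"
      using v \<open>c > 0\<close> by (simp add: field_simps)
    finally show "infdist (c *\<^sub>R x) V \<le> c * infdist x V + e" .
  qed
qed

text \<open>The distance to a subspace is sublinear and at most the norm, so the Hahn-Banach theorem yields a
bounded functional. The zero subspace gives norming functionals, a closed subspace gives
functionals separating it from a point.\<close>

lemma functional_attaining_infdist:
  fixes V :: "'a::real_normed_vector set"
  assumes "subspace V"
  obtains f :: "'a \<Rightarrow>\<^sub>L real"
  where "blinfun_apply f a = infdist a V" "\<And>x. blinfun_apply f x \<le> infdist x V"
proof -
  obtain g where g: "linear g" "\<And>x. g x \<le> infdist x V" "g a = infdist a V"
    using Hahn_Banach_sublinear[OF sublinear_infdist[OF assms]] by blast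
  have le: "g x \<le> norm x" for x
    using g(2)[of x] infdist_le[OF subspace_0[OF assms], of x] by (simp add: dist_norm)
  have "norm (g x) \<le> norm x * 1" for x
    using le[of x] le[of "- x"] linear_neg[OF g(1), of x] by (simp add: abs_le_iff)
  then have "bounded_linear g"
    using g(1) by (intro bounded_linear_intro[where K = 1]) (auto simp: linear_add linear_scale)
  then show thesis
    using g that[of "Blinfun g"] by (simp add: bounded_linear_Blinfun_apply)
qed

lemma norming_functional:
  fixes a :: "'a::real_normed_vector"
  obtains f :: "'a \<Rightarrow>\<^sub>L real"
  where "blinfun_apply f a = norm a" "\<And>x. blinfun_apply f x \<le> norm x"
  using functional_attaining_infdist[OF subspace_single_0, of a]
  by (auto simp: infdist_def dist_norm)

section \<open>The weak topology\<close>

lemma topspace_weak_topology [simp]: "topspace weak_topology = UNIV"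
  by (simp add: weak_topology_def topspace_pullback_topology)

lemma openin_weak_topology:
  "openin weak_topology S \<longleftrightarrow>
    (\<exists>U. open U \<and> S = (\<lambda>x (f :: 'a::real_normed_vector \<Rightarrow>\<^sub>L real). blinfun_apply f x) -` U)"
  by (simp add: weak_topology_def openin_pullback_topology)

lemma continuous_map_blinfun_weak:
  "continuous_map weak_topology euclideanreal (blinfun_apply f)"
proof -
  have "continuous_map euclidean euclideanreal (\<lambda>\<phi>. \<phi> f)"
    by (auto intro: continuous_intros)
  then have "continuous_map weak_topology euclideanreal ((\<lambda>\<phi>. \<phi> f) \<circ> (\<lambda>x f. blinfun_apply f x))"
    unfolding weak_topology_def by (rule continuous_map_pullback)
  then show ?thesis by (simp add: o_def)
qed

lemma closedin_weak_halfspace: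
  fixes f :: "'a::real_normed_vector \<Rightarrow>\<^sub>L real"
  shows "closedin weak_topology {x. blinfun_apply f x \<le> c}"
  using closedin_continuous_map_preimage[OF continuous_map_blinfun_weak[of f], of "{..c}"]
  by simp

text \<open>A ball is the intersection of the half-spaces given by functionals of norm at most one.\<close>

lemma closedin_weak_cball: "closedin weak_topology (cball (a :: 'a::real_normed_vector) r)"
proof -
  define N :: "('a \<Rightarrow>\<^sub>L real) set" where "N = {f. \<forall>x. blinfun_apply f x \<le> norm x}"
  have "cball a r = (\<Inter>f\<in>N. {x. blinfun_apply f x \<le> blinfun_apply f a + r})"
  proof safe
    fix f x assume "f \<in> N" "x \<in> cball a r"
    then have "blinfun_apply f (x - a) \<le> norm (x - a)" "norm (x - a) \<le> r"
      by (auto simp: N_def dist_norm norm_minus_commute[of a x])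
    then show "blinfun_apply f x \<le> blinfun_apply f a + r"
      by (simp add: blinfun.diff_right)
  next
    fix x assume x: "x \<in> (\<Inter>f\<in>N. {x. blinfun_apply f x \<le> blinfun_apply f a + r})"
    obtain f :: "'a \<Rightarrow>\<^sub>L real"
      where f: "blinfun_apply f (x - a) = norm (x - a)" "\<And>y. blinfun_apply f y \<le> norm y"
      using norming_functional by blast
    then have "blinfun_apply f x \<le> blinfun_apply f a + r"
      using x by (auto simp: N_def)
    then show "x \<in> cball a r"
      using f by (simp add: blinfun.diff_right dist_norm norm_minus_commute)
  qed
  moreover have "N \<noteq> {}"
    by (auto simp: N_def intro!: exI[of _ 0])
  moreover from this
  have "closedin weak_topology (\<Inter>f\<in>N. {x. blinfun_apply f x \<le> blinfun_apply f a + r})"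
    by (intro closedin_INT closedin_weak_halfspace)
  ultimately show ?thesis
    by simp
qed

lemma Hausdorff_space_weak_topology: "Hausdorff_space weak_topology"
  unfolding Hausdorff_space_def
proof (intro allI impI)
  fix x y :: 'a assume "x \<in> topspace weak_topology \<and> y \<in> topspace weak_topology \<and> x \<noteq> y"
  moreover obtain f :: "'a \<Rightarrow>\<^sub>L real" where "blinfun_apply f (x - y) = norm (x - y)"
    using norming_functional by blast
  ultimately have "blinfun_apply f x \<noteq> blinfun_apply f y"
    by (auto simp: blinfun.diff_right)
  from hausdorff[OF this] obtain U V
    where UV: "open U" "open V" "blinfun_apply f x \<in> U" "blinfun_apply f y \<in> V" "U \<inter> V = {}"
    by auto
  have "openin weak_topology (blinfun_apply f -` W)" if "open W" for W
    using openin_continuous_map_preimage[OF continuous_map_blinfun_weak[of f], of W] that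
    by (simp add: vimage_def)
  then show "\<exists>U V. openin weak_topology U \<and> openin weak_topology V \<and> x \<in> U \<and> y \<in> V \<and> disjnt U V"
    using UV unfolding disjnt_def
    by (intro exI[of _ "blinfun_apply f -` U"] exI[of _ "blinfun_apply f -` V"]) auto
qed

lemma closedin_weak_imp_closed:
  assumes "closedin weak_topology (S :: 'a::real_normed_vector set)"
  shows "closed S"
proof -
  have "continuous_map euclidean weak_topology (id :: 'a \<Rightarrow> 'a)"
    unfolding weak_topology_def
  proof (rule continuous_map_pullback')
    show "continuous_map euclidean euclidean ((\<lambda>x (f :: 'a \<Rightarrow>\<^sub>L real). blinfun_apply f x) \<circ> id)"
      by (auto intro!: continuous_on_coordinatewise_then_product continuous_intros)
  qed auto
  from closedin_continuous_map_preimage[OF this assms] show ?thesis by simp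
qed

text \<open>The functionals that are dominated by the distance to \<open>V\<close> are nonpositive on \<open>V\<close>, and for every point
outside the closed set \<open>V\<close> one of them is positive there.\<close>

lemma closedin_weak_closed_subspace:
  assumes "subspace V" "closed (V :: 'a::real_normed_vector set)"
  shows "closedin weak_topology V"
proof -
  define N :: "('a \<Rightarrow>\<^sub>L real) set" where "N = {f. \<forall>x. blinfun_apply f x \<le> infdist x V}"
  have "V = (\<Inter>f\<in>N. {x. blinfun_apply f x \<le> 0})"
  proof safe
    fix f x assume "f \<in> N" "x \<in> V"
    then have "blinfun_apply f x \<le> infdist x V"
      unfolding N_def by blast
    then show "blinfun_apply f x \<le> 0"
      using infdist_zero[OF \<open>x \<in> V\<close>] by simp
  next
    fix x assume x: "x \<in> (\<Inter>f\<in>N. {x. blinfun_apply f x \<le> 0})"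
    obtain f :: "'a \<Rightarrow>\<^sub>L real"
      where f: "blinfun_apply f x = infdist x V" "\<And>y. blinfun_apply f y \<le> infdist y V"
      using functional_attaining_infdist[OF assms(1)] by blast
    then have "infdist x V = 0"
      using x infdist_nonneg[of x V] by (fastforce simp: N_def)
    moreover have "V \<noteq> {}"
      using subspace_0[OF assms(1)] by blast
    ultimately show "x \<in> V"
      using in_closed_iff_infdist_zero[OF assms(2)] by simp
  qed
  moreover have "N \<noteq> {}"
    by (auto simp: N_def infdist_nonneg intro!: exI[of _ 0])
  moreover from this have "closedin weak_topology (\<Inter>f\<in>N. {x. blinfun_apply f x \<le> 0})"
    by (intro closedin_INT closedin_weak_halfspace)
  ultimately show ?thesis
    by simp
qed

section \<open>Minimal closed sets\<close>

lemma finite_chain_Inter_mem: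
  assumes "finite \<F>" "\<F> \<noteq> {}" "\<And>A B. A \<in> \<F> \<Longrightarrow> B \<in> \<F> \<Longrightarrow> A \<subseteq> B \<or> B \<subseteq> A"
  shows "\<Inter>\<F> \<in> \<F>"
  using assms
proof (induction rule: finite_ne_induct)
  case (insert A \<F>)
  then have "\<Inter>\<F> \<in> \<F>" by blast
  then have "A \<subseteq> \<Inter>\<F> \<or> \<Inter>\<F> \<subseteq> A"
    using insert.prems by blast
  then show ?case
    using \<open>\<Inter>\<F> \<in> \<F>\<close> by (auto simp: Int_absorb1 Int_absorb2)
qed auto

text \<open>Zorn's lemma for reverse inclusion; the intersection of a chain is nonempty by compactness. This is
applied to invariant sets and to convex invariant sets.\<close>

lemma exists_minimal_closedin:
  assumes K: "compactin X K" "closedin X K" "K \<noteq> {}" "P K"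
    and Inter: "\<And>\<C>. \<C> \<noteq> {} \<Longrightarrow> (\<And>C. C \<in> \<C> \<Longrightarrow> P C) \<Longrightarrow> P (\<Inter>\<C>)"
  obtains M where "closedin X M" "M \<noteq> {}" "M \<subseteq> K" "P M"
    "\<And>N. closedin X N \<Longrightarrow> N \<noteq> {} \<Longrightarrow> N \<subseteq> M \<Longrightarrow> P N \<Longrightarrow> N = M"
proof -
  define \<A> where "\<A> = {C. closedin X C \<and> C \<noteq> {} \<and> C \<subseteq> K \<and> P C}"
  have "\<exists>M\<in>\<A>. \<forall>N\<in>\<A>. M \<supseteq> N \<longrightarrow> N = M"
  proof (rule predicate_Zorn)
    show "partial_order_on \<A> (relation_of (\<supseteq>) \<A>)"
      by (rule partial_order_on_relation_ofI) auto
  next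
    fix \<C> assume \<C>: "\<C> \<in> Chains (relation_of (\<supseteq>) \<A>)"
    then have sub: "\<C> \<subseteq> \<A>" and total: "\<And>A B. A \<in> \<C> \<Longrightarrow> B \<in> \<C> \<Longrightarrow> A \<subseteq> B \<or> B \<subseteq> A"
      by (auto simp: Chains_def relation_of_def)
    show "\<exists>U\<in>\<A>. \<forall>C\<in>\<C>. U \<subseteq> C"
    proof (cases "\<C> = {}")
      case True
      then show ?thesis
        using K by (auto simp: \<A>_def)
    next
      case False
      have "K \<inter> \<Inter>\<C> \<noteq> {}"
      proof -
        have "K \<inter> \<Inter>\<F> \<noteq> {}" if "finite \<F>" "\<F> \<subseteq> \<C>" for \<F>
        proof (cases "\<F> = {}")
          case False
          then have "\<Inter>\<F> \<in> \<F>"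
            by (rule finite_chain_Inter_mem[OF \<open>finite \<F>\<close>]) (use total that in blast)
          then have "\<Inter>\<F> \<in> \<A>"
            using that sub by blast
          then show ?thesis
            by (auto simp: \<A>_def)
        qed (use K in auto)
        moreover have "\<forall>C\<in>\<C>. closedin X C"
          using sub by (auto simp: \<A>_def)
        ultimately show ?thesis
          using K(1) unfolding compactin_fip by blast
      qed
      moreover have "closedin X (\<Inter>\<C>)" "\<Inter>\<C> \<subseteq> K" "P (\<Inter>\<C>)"
        using False sub by (auto simp: \<A>_def intro!: closedin_Inter Inter)
      ultimately have "\<Inter>\<C> \<in> \<A>"
        by (auto simp: \<A>_def)
      then show ?thesis by blast
    qed
  qed
  then obtain M where "M \<in> \<A>" and M: "\<And>N. N \<in> \<A> \<Longrightarrow> N \<subseteq> M \<Longrightarrow> N = M" by blast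
  show thesis
  proof (rule that)
    fix N assume "closedin X N" "N \<noteq> {}" "N \<subseteq> M" "P N"
    then show "N = M"
      using \<open>M \<in> \<A>\<close> by (intro M) (auto simp: \<A>_def)
  qed (use \<open>M \<in> \<A>\<close> in \<open>auto simp: \<A>_def\<close>)
qed

section \<open>Isometries and normal structure of norm compact sets\<close>

text \<open>A point \<open>y\<close> outside the closed image would have some distance \<open>e > 0\<close> from it. Applying powers of \<open>g\<close>
shows that any two points of the forward orbit of \<open>y\<close> are then at distance at least \<open>e\<close>, so the orbit
has no convergent subsequence.\<close>

lemma compact_isometry_surj:
  fixes F :: "'a::metric_space set"
  assumes "compact F" and into: "g ` F \<subseteq> F"
    and iso: "\<And>x y. x \<in> F \<Longrightarrow> y \<in> F \<Longrightarrow> dist (g x) (g y) = dist x y"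
  shows "g ` F = F"
proof (rule ccontr)
  assume "g ` F \<noteq> F"
  then obtain y where y: "y \<in> F" "y \<notin> g ` F"
    using into by blast
  have "continuous_on F g"
    using iso by (auto simp: continuous_on_iff)
  then have "closed (g ` F)"
    using assms(1) compact_continuous_image compact_imp_closed by blast
  define e where "e = infdist y (g ` F)"
  have "e > 0"
    unfolding e_def using \<open>closed (g ` F)\<close> y by (intro infdist_pos_not_in_closed) auto
  have e: "e \<le> dist y z" if "z \<in> g ` F" for z
    unfolding e_def using that by (rule infdist_le)
  have mem: "(g ^^ n) y \<in> F" for n
    using y(1) into by (induction n) auto
  have dist_ge: "e \<le> dist ((g ^^ n) y) ((g ^^ (n + Suc k)) y)" for n k
  proof (induction n)
    case 0
    show ?case
      using e mem[of k] by auto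
  next
    case (Suc n)
    then show ?case
      using iso[OF mem[of n] mem[of "n + Suc k"]] by simp
  qed
  obtain l r where "strict_mono (r :: nat \<Rightarrow> nat)" "(\<lambda>n. (g ^^ r n) y) \<longlonglongrightarrow> l"
    using assms(1) mem by (force simp: compact_def o_def)
  then have "Cauchy (\<lambda>n. (g ^^ r n) y)"
    by (intro LIMSEQ_imp_Cauchy)
  then obtain N where N: "dist ((g ^^ r N) y) ((g ^^ r (Suc N)) y) < e"
    using \<open>e > 0\<close> unfolding Cauchy_def by (metis le_refl le_SucI)
  moreover have "r N < r (Suc N)"
    using \<open>strict_mono r\<close> by (simp add: strict_mono_def)
  then obtain k where "r (Suc N) = r N + Suc k"
    using less_imp_Suc_add by auto
  ultimately show False
    using dist_ge[of "r N" k] by simp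
qed

text \<open>Take \<open>u\<close> to be the mean of the centres of finitely many balls of radius half the diameter \<open>d\<close> that
cover \<open>F\<close>. Each point of \<open>F\<close> is within \<open>d\<close> of all \<open>n\<close> centres and within \<open>d / 2\<close> of at least one, so
averaging gives the radius \<open>d - d / (2 * n)\<close>.\<close>

lemma compact_normal_structure:
  fixes F :: "'a::real_normed_vector set"
  assumes "compact F" "x \<in> F" "y \<in> F" "x \<noteq> y"
  obtains u r where "u \<in> convex hull F" "r < diameter F" "F \<subseteq> cball u r"
proof -
  define d where "d = diameter F"
  have "bounded F"
    using assms(1) by (rule compact_imp_bounded)
  then have d: "dist a b \<le> d" if "a \<in> F" "b \<in> F" for a b
    using that by (simp add: d_def diameter_bounded_bound)
  have "d > 0"
    using d[OF assms(2,3)] assms(4) zero_less_dist_iff[of x y] by linarith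
  then have "F \<subseteq> (\<Union>c\<in>F. ball c (d / 2))"
    by auto
  then obtain k where k: "k \<subseteq> F" "finite k" "F \<subseteq> (\<Union>c\<in>k. ball c (d / 2))"
    by (rule compactE_image[OF assms(1) open_ball])
  define n where "n = card k"
  have "k \<noteq> {}"
    using k(3) assms(2) by auto
  then have n: "n > 0"
    using k(2) by (simp add: n_def card_gt_0_iff)
  define u where "u = (\<Sum>c\<in>k. (1 / n) *\<^sub>R c)"
  have "u \<in> convex hull F"
    unfolding u_def
    by (rule convex_sum[OF k(2) convex_convex_hull]) (use k n in \<open>auto simp: n_def hull_inc\<close>)
  moreover have "dist u z \<le> d - d / (2 * n)" if z: "z \<in> F" for z
  proof -
    obtain c where c: "c \<in> k" "dist c z < d / 2"
      using k(3) z by auto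
    have "u - z = (\<Sum>c\<in>k. (1 / n) *\<^sub>R (c - z))"
      using n by (simp add: u_def scaleR_diff_right sum_subtractf n_def scaleR_sum_right[symmetric] sum_constant_scaleR)
    then have "dist u z \<le> (\<Sum>c\<in>k. (1 / n) * dist c z)"
      using norm_sum[of "\<lambda>c. (1 / n) *\<^sub>R (c - z)" k] by (simp add: dist_norm)
    also have "\<dots> = (1 / n) * dist c z + (\<Sum>c\<in>k - {c}. (1 / n) * dist c z)"
      using k(2) c(1) by (simp add: sum.remove)
    also have "\<dots> \<le> (1 / n) * (d / 2) + (\<Sum>c\<in>k - {c}. (1 / n) * d)"
      using c k(1) z d n by (intro add_mono sum_mono mult_left_mono) auto
    also have "\<dots> = d - d / (2 * n)"
      using n k(2) c(1) by (simp add: n_def[symmetric] of_nat_diff field_simps)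
    finally show ?thesis .
  qed
  then have "F \<subseteq> cball u (d - d / (2 * n))"
    by auto
  moreover have "d - d / (2 * n) < diameter F"
    using n \<open>d > 0\<close> by (simp add: d_def)
  ultimately show thesis
    by (intro that)
qed

section \<open>Separability\<close>

text \<open>The rational linear combinations of elements of \<open>D\<close> serve as \<open>E\<close>.\<close>

lemma countable_dense_closed_subspace:
  fixes D :: "'a::real_normed_vector set"
  assumes "countable D"
  obtains E where "countable E" "subspace (closure E)" "D \<subseteq> closure E"
proof -
  define comb :: "(real \<times> 'a) list \<Rightarrow> 'a" where "comb xs = (\<Sum>(q, d)\<leftarrow>xs. q *\<^sub>R d)" for xs
  define E where "E = comb ` lists (\<rat> \<times> D)"
  have "countable E"
    unfolding E_def using assms countable_rat by (intro countable_image countable_lists) auto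
  moreover have "D \<subseteq> E"
  proof
    fix d assume "d \<in> D"
    then have "d = comb [(1, d)]" "[(1, d)] \<in> lists (\<rat> \<times> D)"
      by (auto simp: comb_def)
    then show "d \<in> E"
      unfolding E_def by blast
  qed
  then have "D \<subseteq> closure E"
    using closure_subset by blast
  moreover have "subspace (closure E)"
  proof (rule subspaceI)
    have "comb [] \<in> E"
      by (simp add: E_def)
    then show "0 \<in> closure E"
      using closure_subset by (auto simp: comb_def)
  next
    have add: "(\<lambda>(x, y). x + y) ` (E \<times> E) \<subseteq> closure E"
    proof -
      have "comb xs + comb ys \<in> E" if "xs \<in> lists (\<rat> \<times> D)" "ys \<in> lists (\<rat> \<times> D)" for xs ys
      proof -
        have "comb xs + comb ys = comb (xs @ ys)"
          by (simp add: comb_def)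
        then show ?thesis
          using that by (simp add: E_def)
      qed
      then have "(\<lambda>(x, y). x + y) ` (E \<times> E) \<subseteq> E"
        by (auto simp: E_def)
      then show ?thesis
        using closure_subset by blast
    qed
    have "(\<lambda>(x, y). x + y) ` closure (E \<times> E) \<subseteq> closure E"
      by (rule image_closure_subset[OF _ closed_closure add])
         (auto intro!: continuous_intros simp: split_beta)
    then show "x + y \<in> closure E" if "x \<in> closure E" "y \<in> closure E" for x y
      using that by (auto simp: closure_Times)
  next
    have scale: "(\<lambda>(c, x). c *\<^sub>R x) ` (\<rat> \<times> E) \<subseteq> closure E"
    proof -
      have "c *\<^sub>R comb xs \<in> E" if "c \<in> \<rat>" "xs \<in> lists (\<rat> \<times> D)" for c xs
      proof -
        have "c *\<^sub>R comb xs = comb (map (\<lambda>(q, d). (c * q, d)) xs)"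
          by (induction xs) (auto simp: comb_def scaleR_add_right)
        moreover have "map (\<lambda>(q, d). (c * q, d)) xs \<in> lists (\<rat> \<times> D)"
          using that(2) by (induction xs) (auto simp: that(1))
        ultimately show ?thesis
          by (simp add: E_def)
      qed
      then have "(\<lambda>(c, x). c *\<^sub>R x) ` (\<rat> \<times> E) \<subseteq> E"
        by (auto simp: E_def)
      then show ?thesis
        using closure_subset by blast
    qed
    have "(\<lambda>(c, x). c *\<^sub>R x) ` closure (\<rat> \<times> E) \<subseteq> closure E"
      by (rule image_closure_subset[OF _ closed_closure scale])
         (auto intro!: continuous_intros simp: split_beta)
    then show "c *\<^sub>R x \<in> closure E" if "x \<in> closure E" for c x
      using that by (auto simp: closure_Times Rats_closure_real)
  qed
  ultimately show thesis by (intro that)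
qed

section \<open>Minimal systems of weakly continuous isometries\<close>

text \<open>Baire's theorem: the compact Hausdorff space \<open>F\<close> with its weak topology is covered by countably many
balls of radius \<open>e / 2\<close>, and these are weakly closed. Hence one of them has weak interior in \<open>F\<close>.\<close>

lemma weakly_open_small_piece:
  fixes F :: "'a::real_normed_vector set"
  assumes "compactin weak_topology F" "F \<noteq> {}" "countable E" "F \<subseteq> closure E" "e > 0"
  obtains U where "openin weak_topology U" "U \<inter> F \<noteq> {}"
    "\<And>x y. x \<in> U \<inter> F \<Longrightarrow> y \<in> U \<inter> F \<Longrightarrow> dist x y \<le> e"
proof -
  define T where "T = subtopology weak_topology F"
  have [simp]: "topspace T = F"
    by (simp add: T_def)
  have "compact_space T" "Hausdorff_space T"
    using assms(1) Hausdorff_space_weak_topology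
    by (auto simp: T_def compactin_subspace intro: Hausdorff_space_subtopology)
  then have Baire: "locally_compact_space T \<and> regular_space T"
    by (simp add: compact_imp_locally_compact_space compact_Hausdorff_imp_regular_space)
  define \<G> where "\<G> = (\<lambda>c. F \<inter> cball c (e / 2)) ` E"
  have "\<Union>\<G> = F"
  proof
    show "F \<subseteq> \<Union>\<G>"
    proof
      fix x assume "x \<in> F"
      then obtain c where "c \<in> E" "dist c x < e / 2"
        using assms(4,5) closure_approachable[of x E] by (metis half_gt_zero subsetD)
      then show "x \<in> \<Union>\<G>"
        using \<open>x \<in> F\<close> by (force simp: \<G>_def)
    qed
  qed (auto simp: \<G>_def)
  have "\<exists>c\<in>E. T interior_of (F \<inter> cball c (e / 2)) \<noteq> {}"
  proof (rule ccontr)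
    assume "\<not> ?thesis"
    moreover have "closedin T (F \<inter> cball c (e / 2))" for c
      unfolding T_def by (intro closedin_subtopology_Int_closed closedin_weak_cball)
    ultimately have "T interior_of \<Union>\<G> = {}"
      using Baire assms(3) by (intro Baire_category_alt) (auto simp: \<G>_def)
    moreover have "T interior_of F = F"
      using interior_of_topspace[of T] by simp
    ultimately show False
      using \<open>\<Union>\<G> = F\<close> assms(2) by simp
  qed
  then obtain c where c: "T interior_of (F \<inter> cball c (e / 2)) \<noteq> {}" by blast
  obtain U where U: "openin weak_topology U" "T interior_of (F \<inter> cball c (e / 2)) = U \<inter> F"
    using openin_interior_of[of T "F \<inter> cball c (e / 2)"] unfolding T_def openin_subtopology by blast
  then have sub: "U \<inter> F \<subseteq> cball c (e / 2)"
    using interior_of_subset[of T "F \<inter> cball c (e / 2)"] by auto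
  show thesis
  proof (rule that)
    fix x y assume "x \<in> U \<inter> F" "y \<in> U \<inter> F"
    then have "dist c x \<le> e / 2" "dist c y \<le> e / 2"
      using sub by auto
    then show "dist x y \<le> e"
      using dist_triangle3[of x y c] by linarith
  qed (use U c in auto)
qed

text \<open>The images of \<open>x\<close> under all finite words in \<open>G\<close>, the empty word included; the words form the
monoid generated by \<open>G\<close>.\<close>

definition orbit :: "('a \<Rightarrow> 'a) set \<Rightarrow> 'a \<Rightarrow> 'a set" where
  "orbit G x = (\<lambda>gs. foldr (\<lambda>g. g) gs x) ` lists G"

lemma orbit_refl: "x \<in> orbit G x"
  unfolding orbit_def by (rule image_eqI[of _ _ "[]"]) auto

lemma orbit_step: "g \<in> G \<Longrightarrow> y \<in> orbit G x \<Longrightarrow> g y \<in> orbit G x"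
  unfolding orbit_def by (force intro: image_eqI[of _ _ "g # _"])

lemma countable_orbit: "countable G \<Longrightarrow> countable (orbit G x)"
  unfolding orbit_def by (intro countable_image countable_lists)

lemma orbit_subset:
  assumes "x \<in> F" "\<And>g. g \<in> G \<Longrightarrow> g ` F \<subseteq> F"
  shows "orbit G x \<subseteq> F"
proof -
  have "foldr (\<lambda>g. g) gs x \<in> F" if "gs \<in> lists G" for gs
    using that by induction (use assms in auto)
  then show ?thesis
    by (auto simp: orbit_def)
qed

locale weak_isometry_system =
  fixes G :: "('a::banach \<Rightarrow> 'a) set"
  assumes weakly_continuous: "\<And>g. g \<in> G \<Longrightarrow> continuous_map weak_topology weak_topology g"
    and isometric: "\<And>g x y. g \<in> G \<Longrightarrow> dist (g x) (g y) = dist x y"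
begin

definition invariant :: "'a set \<Rightarrow> bool" where
  "invariant F \<longleftrightarrow> (\<forall>g\<in>G. g ` F \<subseteq> F)"

lemma invariant_Inter: "(\<And>C. C \<in> \<C> \<Longrightarrow> invariant C) \<Longrightarrow> invariant (\<Inter>\<C>)"
  by (force simp: invariant_def)

lemma word_weakly_continuous:
  "gs \<in> lists G \<Longrightarrow> continuous_map weak_topology weak_topology (foldr (\<lambda>g. g) gs)"
proof (induction rule: lists.induct)
  case Nil
  then show ?case by (simp add: id_def[symmetric])
next
  case (Cons g gs)
  then show ?case
    using continuous_map_compose[OF Cons.IH weakly_continuous[OF Cons.hyps(1)]]
    by (simp add: o_def)
qed

lemma word_isometric:
  "gs \<in> lists G \<Longrightarrow> dist (foldr (\<lambda>g. g) gs x) (foldr (\<lambda>g. g) gs y) = dist x y"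
  by (induction rule: lists.induct) (auto simp: isometric)

lemma orbit_weakly_dense:
  assumes F: "closedin weak_topology F" "invariant F"
    and minimal: "\<And>N. closedin weak_topology N \<Longrightarrow> N \<noteq> {} \<Longrightarrow> N \<subseteq> F \<Longrightarrow> invariant N \<Longrightarrow> N = F"
    and "x \<in> F"
  shows "weak_topology closure_of orbit G x = F"
proof (rule minimal)
  show "closedin weak_topology (weak_topology closure_of orbit G x)"
    by simp
  show "weak_topology closure_of orbit G x \<noteq> {}"
    using orbit_refl[of x G] closure_of_subset[of "orbit G x" weak_topology] by auto
  have "orbit G x \<subseteq> F"
    by (rule orbit_subset[OF assms(4)]) (use F(2) in \<open>auto simp: invariant_def\<close>)
  then show "weak_topology closure_of orbit G x \<subseteq> F"
    using F(1) by (rule closure_of_minimal)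
  show "invariant (weak_topology closure_of orbit G x)"
    unfolding invariant_def
  proof
    fix g assume g: "g \<in> G"
    have "g ` (weak_topology closure_of orbit G x) \<subseteq> weak_topology closure_of (g ` orbit G x)"
      using weakly_continuous[OF g] by (rule continuous_map_image_closure_subset)
    also have "\<dots> \<subseteq> weak_topology closure_of orbit G x"
      using orbit_step[OF g] by (intro closure_of_mono) auto
    finally show "g ` (weak_topology closure_of orbit G x) \<subseteq> weak_topology closure_of orbit G x" .
  qed
qed

text \<open>On a minimal set the weak topology, in which the set is compact, dominates the norm. The weak
closure of a single orbit is all of \<open>F\<close> by minimality, so \<open>F\<close> lies in a separable closed subspace and
has a nonempty relatively weakly open piece \<open>U\<close> of small diameter. Every orbit enters \<open>U\<close>, hence \<open>F\<close> is
covered by weakly open preimages of \<open>U\<close> under words; as words are isometries, these preimages are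
as small as \<open>U\<close>. A finite subcover shows that \<open>F\<close> is totally bounded.\<close>

lemma minimal_invariant_compact:
  assumes "countable G"
    and F: "compactin weak_topology F" "F \<noteq> {}" "invariant F"
    and minimal: "\<And>N. closedin weak_topology N \<Longrightarrow> N \<noteq> {} \<Longrightarrow> N \<subseteq> F \<Longrightarrow> invariant N \<Longrightarrow> N = F"
  shows "compact F"
proof -
  have closed: "closedin weak_topology F"
    using compactin_imp_closedin[OF Hausdorff_space_weak_topology F(1)] .
  have dense: "weak_topology closure_of orbit G x = F" if "x \<in> F" for x
    by (rule orbit_weakly_dense[OF closed F(3) minimal that])
  obtain x where "x \<in> F"
    using F(2) by blast
  obtain E where E: "countable E" "subspace (closure E)" "orbit G x \<subseteq> closure E"
    using countable_dense_closed_subspace[OF countable_orbit[OF assms(1)]] .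
  have "F \<subseteq> closure E"
    using closure_of_minimal[OF E(3) closedin_weak_closed_subspace[OF E(2) closed_closure]]
      dense[OF \<open>x \<in> F\<close>] by simp
  have "\<exists>k. finite k \<and> F \<subseteq> (\<Union>c\<in>k. ball c e)" if e: "e > 0" for e
  proof -
    obtain U where U: "openin weak_topology U" "U \<inter> F \<noteq> {}"
      "\<And>x y. x \<in> U \<inter> F \<Longrightarrow> y \<in> U \<inter> F \<Longrightarrow> dist x y \<le> e / 2"
      using weakly_open_small_piece[OF F(1,2) E(1) \<open>F \<subseteq> closure E\<close> half_gt_zero[OF e]] by blast
    define V where "V gs = foldr (\<lambda>g. g) gs -` U" for gs :: "('a \<Rightarrow> 'a) list"
    have "openin weak_topology (V gs)" if "gs \<in> lists G" for gs
      using openin_continuous_map_preimage[OF word_weakly_continuous[OF that] U(1)]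
      by (simp add: V_def vimage_def)
    moreover have "F \<subseteq> \<Union>(V ` lists G)"
    proof
      fix y assume "y \<in> F"
      obtain z where "z \<in> U" "z \<in> F"
        using U(2) by blast
      then have "\<exists>w\<in>orbit G y. w \<in> U"
        using dense[OF \<open>y \<in> F\<close>] U(1) in_closure_of[of z weak_topology "orbit G y"] by blast
      then show "y \<in> \<Union>(V ` lists G)"
        by (auto simp: orbit_def V_def)
    qed
    ultimately obtain \<V> where \<V>: "finite \<V>" "\<V> \<subseteq> V ` lists G" "F \<subseteq> \<Union>\<V>"
      using compactinD[OF F(1), of "V ` lists G"] by (metis imageE)
    have small: "dist y z < e" if y: "y \<in> F \<inter> W" and z: "z \<in> F \<inter> W" and W: "W \<in> \<V>" for y z W
    proof -
      obtain gs where gs: "gs \<in> lists G" "W = V gs"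
        using W \<V>(2) by blast
      have "foldr (\<lambda>g. g) gs w \<in> U \<inter> F" if "w \<in> F \<inter> W" for w
        using that gs orbit_subset[of w F G] F(3) by (auto simp: V_def orbit_def invariant_def)
      then have "dist (foldr (\<lambda>g. g) gs y) (foldr (\<lambda>g. g) gs z) \<le> e / 2"
        using U(3) y z by blast
      then show ?thesis
        using \<open>e > 0\<close> by (simp add: word_isometric[OF gs(1)])
    qed
    define pt where "pt W = (SOME y. y \<in> F \<inter> W)" for W
    have "F \<subseteq> (\<Union>c\<in>pt ` \<V>. ball c e)"
    proof
      fix y assume "y \<in> F"
      then obtain W where W: "W \<in> \<V>" "y \<in> F \<inter> W"
        using \<V>(3) by blast
      then have "pt W \<in> F \<inter> W"
        unfolding pt_def by (metis someI)
      then show "y \<in> (\<Union>c\<in>pt ` \<V>. ball c e)"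
        using small W by auto
    qed
    then show ?thesis
      using \<V>(1) by blast
  qed
  moreover have "complete F"
    using closedin_weak_imp_closed[OF closed] by (simp add: complete_eq_closed)
  ultimately show ?thesis
    by (simp add: compact_eq_totally_bounded)
qed

subsection \<open>Common fixed points\<close>

text \<open>Let \<open>M\<close> be a minimal convex invariant set and \<open>F\<close> a minimal invariant subset of \<open>M\<close>. Since each \<open>g\<close> maps
the norm compact set \<open>F\<close> onto itself, the set of points of \<open>M\<close> from which all of \<open>F\<close> is within distance
\<open>r\<close> is again invariant, in addition to being convex and weakly closed. If \<open>F\<close> had two points, normal
structure would make this set nonempty for some \<open>r\<close> below the diameter of \<open>F\<close>. By minimality it
would be all of \<open>M\<close>, hence contain \<open>F\<close>, and the diameter of \<open>F\<close> would be at most \<open>r\<close>.\<close>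

theorem common_fixed_point_countable:
  assumes "countable G"
    and K: "compactin weak_topology K" "convex K" "K \<noteq> {}" "invariant K"
  obtains x where "x \<in> K" "\<And>g. g \<in> G \<Longrightarrow> g x = x"
proof -
  have closed: "closedin weak_topology S" if "compactin weak_topology S" for S :: "'a set"
    using compactin_imp_closedin[OF Hausdorff_space_weak_topology that] .
  obtain M where M: "closedin weak_topology M" "M \<noteq> {}" "M \<subseteq> K" "convex M \<and> invariant M"
    and M_min: "\<And>N. closedin weak_topology N \<Longrightarrow> N \<noteq> {} \<Longrightarrow> N \<subseteq> M \<Longrightarrow> convex N \<and> invariant N \<Longrightarrow> N = M"
    using exists_minimal_closedin[OF K(1) closed[OF K(1)] K(3), of "\<lambda>C. convex C \<and> invariant C"]
      K(2,4) by (auto intro: convex_Inter invariant_Inter)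
  have M_compact: "compactin weak_topology M"
    using closed_compactin[OF K(1) M(3,1)] .
  obtain F where F: "closedin weak_topology F" "F \<noteq> {}" "F \<subseteq> M" "invariant F"
    and F_min: "\<And>N. closedin weak_topology N \<Longrightarrow> N \<noteq> {} \<Longrightarrow> N \<subseteq> F \<Longrightarrow> invariant N \<Longrightarrow> N = F"
    using exists_minimal_closedin[OF M_compact M(1,2), of invariant] M(4)
    by (auto intro: invariant_Inter)
  have "compact F"
    using minimal_invariant_compact[OF assms(1) closed_compactin[OF M_compact F(3,1)] F(2,4) F_min] .
  then have onto: "g ` F = F" if "g \<in> G" for g
    by (rule compact_isometry_surj) (use F(4) that isometric in \<open>auto simp: invariant_def\<close>)
  obtain x where "x \<in> F"
    using F(2) by blast
  have "y = x" if "y \<in> F" for y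
  proof (rule ccontr)
    assume "y \<noteq> x"
    then obtain u r where u: "u \<in> convex hull F" "F \<subseteq> cball u r" and r: "r < diameter F"
      using compact_normal_structure[OF \<open>compact F\<close> \<open>y \<in> F\<close> \<open>x \<in> F\<close>] by blast
    define N where "N = M \<inter> (\<Inter>z\<in>F. cball z r)"
    have "N = M"
    proof (rule M_min)
      show "closedin weak_topology N"
        unfolding N_def using M(1) F(2) by (intro closedin_Int closedin_INT closedin_weak_cball)
      have "u \<in> M"
        using u(1) hull_minimal[of F M convex] F(3) M(4) by blast
      then have "u \<in> N"
        using u(2) by (auto simp: N_def dist_commute)
      then show "N \<noteq> {}" by blast
      have "invariant N"
        unfolding invariant_def
      proof (intro ballI image_subsetI)
        fix g a assume g: "g \<in> G" and a: "a \<in> N"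
        have "g a \<in> M"
          using M(4) g a by (auto simp: invariant_def N_def)
        moreover have "dist z (g a) \<le> r" if z: "z \<in> F" for z
        proof -
          obtain w where "w \<in> F" "z = g w"
            using onto[OF g] z by blast
          then show ?thesis
            using a by (auto simp: isometric[OF g] N_def)
        qed
        ultimately show "g a \<in> N"
          by (simp add: N_def)
      qed
      moreover have "convex N"
        unfolding N_def using M(4) by (intro convex_Int convex_INT convex_cball) auto
      ultimately show "convex N \<and> invariant N" by simp
    qed (simp add: N_def)
    then have "dist z w \<le> r" if "z \<in> F" "w \<in> F" for z w
      using F(3) that unfolding N_def by (metis IntD2 INT_D mem_cball subsetD)
    then have "diameter F \<le> r"
      using F(2) by (intro diameter_le) (auto simp: dist_norm)
    then show False
      using r by simp
  qed
  then have "F = {x}"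
    using \<open>x \<in> F\<close> by blast
  then show thesis
    using that[of x] onto F(3) M(3) by blast
qed

lemma closedin_fixed_points:
  assumes "g \<in> G"
  shows "closedin weak_topology {x. g x = x}"
  using closedin_continuous_maps_eq[OF Hausdorff_space_weak_topology weakly_continuous[OF assms]
      continuous_map_id] by simp

end

text \<open>Sets of fixed points of weakly continuous maps are weakly closed, though in general not convex. By
weak compactness of \<open>K\<close> it therefore suffices to treat finite subfamilies of \<open>G\<close>, for which orbits are
countable.\<close>

theorem nonlinear_Ryll_Nardzewski:
  fixes G :: "('a::banach \<Rightarrow> 'a) set"
  assumes K: "compactin weak_topology K" "convex K" "K \<noteq> {}"
    and G: "\<And>g. g \<in> G \<Longrightarrow> continuous_map weak_topology weak_topology g"
      "\<And>g x y. g \<in> G \<Longrightarrow> dist (g x) (g y) = dist x y"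
      "\<And>g. g \<in> G \<Longrightarrow> g ` K \<subseteq> K"
  obtains x where "x \<in> K" "\<And>g. g \<in> G \<Longrightarrow> g x = x"
proof -
  define Fix where "Fix g = {x :: 'a. g x = x}" for g
  have "K \<inter> \<Inter>(Fix ` H) \<noteq> {}" if H: "finite H" "H \<subseteq> G" for H
  proof -
    interpret weak_isometry_system H
      by standard (use G H in auto)
    have "invariant K"
      using G(3) H(2) by (auto simp: invariant_def)
    then obtain x where "x \<in> K" "\<And>g. g \<in> H \<Longrightarrow> g x = x"
      using common_fixed_point_countable[OF countable_finite[OF H(1)] K] by blast
    then show ?thesis by (auto simp: Fix_def)
  qed
  then have "\<forall>\<F>. finite \<F> \<and> \<F> \<subseteq> Fix ` G \<longrightarrow> K \<inter> \<Inter>\<F> \<noteq> {}"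
    by (metis finite_subset_image)
  moreover have "\<forall>C\<in>Fix ` G. closedin weak_topology C"
  proof -
    interpret weak_isometry_system G
      by standard (use G in auto)
    show ?thesis
      by (auto simp: Fix_def closedin_fixed_points)
  qed
  ultimately have "K \<inter> \<Inter>(Fix ` G) \<noteq> {}"
    using K(1) unfolding compactin_fip by blast
  then show thesis
    using that by (auto simp: Fix_def)
qed

section \<open>Chebyshev centres\<close>

definition farthest_distance :: "'a::real_normed_vector set \<Rightarrow> 'a \<Rightarrow> real" where
  "farthest_distance A x = (SUP a\<in>A. norm (x - a))"

definition Chebyshev_centers :: "'a::real_normed_vector set \<Rightarrow> 'a set" where
  "Chebyshev_centers A = {x. \<forall>y. farthest_distance A x \<le> farthest_distance A y}"

definition Chebyshev_radius :: "'a::real_normed_vector set \<Rightarrow> real" where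
  "Chebyshev_radius A = (INF x. farthest_distance A x)"

lemma farthest_distance_le_iff:
  assumes "A \<noteq> {}" "bounded A"
  shows "farthest_distance A x \<le> t \<longleftrightarrow> (\<forall>a\<in>A. norm (x - a) \<le> t)"
proof -
  obtain b where "\<And>a. a \<in> A \<Longrightarrow> dist x a \<le> b"
    using assms(2) bounded_any_center[of A x] by blast
  then have "bdd_above ((\<lambda>a. norm (x - a)) ` A)"
    by (auto simp: dist_norm intro!: bdd_aboveI2)
  then show ?thesis
    using assms(1) by (simp add: farthest_distance_def cSUP_le_iff)
qed

lemma farthest_distance_nonneg:
  assumes "A \<noteq> {}" "bounded A"
  shows "0 \<le> farthest_distance A x"
proof -
  obtain a where "a \<in> A"
    using assms(1) by blast
  then have "norm (x - a) \<le> farthest_distance A x"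
    using farthest_distance_le_iff[OF assms, of x "farthest_distance A x"] by simp
  then show ?thesis
    using norm_ge_zero order_trans by blast
qed

lemma Chebyshev_radius_le:
  assumes "A \<noteq> {}" "bounded A"
  shows "Chebyshev_radius A \<le> farthest_distance A x"
  unfolding Chebyshev_radius_def
  using farthest_distance_nonneg[OF assms] by (intro cINF_lower bdd_belowI2[where m = 0]) auto

lemma Chebyshev_radius_nonneg:
  assumes "A \<noteq> {}" "bounded A"
  shows "0 \<le> Chebyshev_radius A"
  unfolding Chebyshev_radius_def
  using farthest_distance_nonneg[OF assms] by (intro cINF_greatest) auto

lemma Chebyshev_centers_eq:
  assumes "A \<noteq> {}" "bounded A"
  shows "Chebyshev_centers A = (\<Inter>a\<in>A. cball a (Chebyshev_radius A))"
proof -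
  have "x \<in> Chebyshev_centers A \<longleftrightarrow> farthest_distance A x \<le> Chebyshev_radius A" for x
  proof
    show "farthest_distance A x \<le> Chebyshev_radius A" if "x \<in> Chebyshev_centers A"
      unfolding Chebyshev_radius_def
      using that by (intro cINF_greatest) (auto simp: Chebyshev_centers_def)
    show "x \<in> Chebyshev_centers A" if "farthest_distance A x \<le> Chebyshev_radius A"
      using that Chebyshev_radius_le[OF assms] order_trans
      unfolding Chebyshev_centers_def by blast
  qed
  then show ?thesis
    by (auto simp: farthest_distance_le_iff[OF assms] dist_norm norm_minus_commute)
qed

lemma isometry_preserves_Chebyshev_centers:
  assumes "\<And>x y. norm (s x - s y) = norm (x - y)" "s ` A = A"
  shows "s ` Chebyshev_centers A \<subseteq> Chebyshev_centers A"
proof -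
  have "farthest_distance A (s x) = farthest_distance A x" for x
  proof -
    have "farthest_distance A (s x) = (SUP a\<in>s ` A. norm (s x - a))"
      using assms(2) by (simp add: farthest_distance_def)
    also have "\<dots> = farthest_distance A x"
      using assms(1) by (simp add: farthest_distance_def image_image)
    finally show ?thesis .
  qed
  then show ?thesis
    by (auto simp: Chebyshev_centers_def)
qed

section \<open>Weak compactness of the set of Chebyshev centres\<close>

text \<open>The weak topology is pulled back along evaluation, so compactness may be tested on the image of
\<open>C\<close> in the product space.\<close>

lemma compactin_weak_if_compact_evaluations:
  assumes "compact ((\<lambda>x (f :: 'a::real_normed_vector \<Rightarrow>\<^sub>L real). blinfun_apply f x) ` C)"
  shows "compactin weak_topology C"
  unfolding compactin_def
proof (intro conjI allI impI)
  fix \<U> :: "'a set set"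
  assume \<U>: "(\<forall>U\<in>\<U>. openin weak_topology U) \<and> C \<subseteq> \<Union>\<U>"
  let ?ev = "\<lambda>x (f :: 'a \<Rightarrow>\<^sub>L real). blinfun_apply f x"
  obtain W where W: "open (W U)" "U = ?ev -` W U" if "U \<in> \<U>" for U
    using \<U> unfolding openin_weak_topology by metis
  have cover: "?ev ` C \<subseteq> (\<Union>U\<in>\<U>. W U)"
    using \<U> W(2) by blast
  obtain \<F> where \<F>: "\<F> \<subseteq> \<U>" "finite \<F>" "?ev ` C \<subseteq> (\<Union>U\<in>\<F>. W U)"
    by (rule compactE_image[OF assms _ cover]) (use W(1) in auto)
  then have "C \<subseteq> \<Union>\<F>"
    using W(2) by blast
  then show "\<exists>\<F>. finite \<F> \<and> \<F> \<subseteq> \<U> \<and> C \<subseteq> \<Union>\<F>"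
    using \<F> by blast
qed simp

text \<open>For nonempty \<open>A\<close> and \<open>t \<ge> 0\<close>, the elements of the bidual within distance \<open>t\<close> of every point
of \<open>A\<close>, represented as plain functions on the dual, without their boundedness, so that the weak
star topology is the product topology and Tychonoff's theorem applies.\<close>

definition bidual_centers :: "'a::real_normed_vector set \<Rightarrow> real \<Rightarrow> (('a \<Rightarrow>\<^sub>L real) \<Rightarrow> real) set" where
  "bidual_centers A t =
    {\<phi>. linear \<phi> \<and> (\<forall>a\<in>A. \<forall>f. \<bar>\<phi> f - blinfun_apply f a\<bar> \<le> t * norm f)}"

lemma closed_bidual_centers: "closed (bidual_centers A t)"
proof -
  have "bidual_centers A t =
    {\<phi>. (\<forall>f g. \<phi> (f + g) = \<phi> f + \<phi> g) \<and> (\<forall>c f. \<phi> (c *\<^sub>R f) = c * \<phi> f) \<and>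
        (\<forall>a\<in>A. \<forall>f. \<bar>\<phi> f - blinfun_apply f a\<bar> \<le> t * norm f)}"
    by (auto simp: bidual_centers_def linear_iff)
  also have "closed \<dots>"
    unfolding Ball_def
    by (intro closed_Collect_conj closed_Collect_all closed_Collect_imp open_Collect_const
          closed_Collect_eq closed_Collect_le continuous_intros) auto
  finally show ?thesis .
qed

lemma compact_bidual_centers:
  assumes "A \<noteq> {}"
  shows "compact (bidual_centers A t)"
proof -
  obtain a where a: "a \<in> A"
    using assms by blast
  define B where "B = Pi\<^sub>E UNIV (\<lambda>f :: 'a \<Rightarrow>\<^sub>L real. cball (blinfun_apply f a) (t * norm f))"
  have "compactin (product_topology (\<lambda>f. euclideanreal) UNIV) B"
    unfolding B_def by (simp add: compactin_PiE)
  then have "compact B"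
    by (simp add: euclidean_product_topology)
  moreover have "bidual_centers A t \<subseteq> B"
    using a by (auto simp: bidual_centers_def B_def dist_real_def abs_minus_commute)
  ultimately show ?thesis
    using closed_bidual_centers[of A t] compact_Int_closed[of B "bidual_centers A t"]
    by (simp add: Int_absorb1)
qed

lemma bidual_centers_mono:
  assumes "s \<le> t"
  shows "bidual_centers A s \<subseteq> bidual_centers A t"
  using assms mult_right_mono[OF assms norm_ge_zero] order_trans
  by (fastforce simp: bidual_centers_def)

lemma evaluation_in_bidual_centers:
  assumes "\<And>a. a \<in> A \<Longrightarrow> norm (x - a) \<le> t"
  shows "(\<lambda>f. blinfun_apply f x) \<in> bidual_centers A t"
  unfolding bidual_centers_def
proof (intro CollectI conjI ballI allI)
  show "linear (\<lambda>f. blinfun_apply f x)"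
    by (intro bounded_linear.linear bounded_linear_intros)
  fix a f assume "a \<in> A"
  have "\<bar>blinfun_apply f x - blinfun_apply f a\<bar> \<le> norm f * norm (x - a)"
    using norm_blinfun[of f "x - a"] by (simp add: blinfun.diff_right)
  also have "\<dots> \<le> t * norm f"
    using mult_left_mono[OF assms[OF \<open>a \<in> A\<close>] norm_ge_zero[of f]] by (simp add: mult.commute)
  finally show "\<bar>blinfun_apply f x - blinfun_apply f a\<bar> \<le> t * norm f" .
qed

lemma bidual_centersE:
  assumes "\<phi> \<in> bidual_centers A t" "A \<noteq> {}" "t \<ge> 0"
  obtains \<Phi> where "blinfun_apply \<Phi> = \<phi>"
    "\<And>a. a \<in> A \<Longrightarrow> norm (\<Phi> - canonical_embedding a) \<le> t"
proof -
  have lin: "linear \<phi>" and le: "\<And>a f. a \<in> A \<Longrightarrow> \<bar>\<phi> f - blinfun_apply f a\<bar> \<le> t * norm f"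
    using assms(1) by (auto simp: bidual_centers_def)
  obtain a where a: "a \<in> A"
    using assms(2) by blast
  have "norm (\<phi> f) \<le> norm f * (t + norm a)" for f
  proof -
    have "\<bar>\<phi> f\<bar> \<le> \<bar>\<phi> f - blinfun_apply f a\<bar> + \<bar>blinfun_apply f a\<bar>"
      by linarith
    also have "\<dots> \<le> t * norm f + norm f * norm a"
      using le[OF a, of f] norm_blinfun[of f a] by simp
    finally show ?thesis
      by (simp add: algebra_simps)
  qed
  then have "bounded_linear \<phi>"
    using lin by (intro bounded_linear_intro[where K = "t + norm a"]) (auto simp: linear_add linear_scale)
  then have apply_\<phi>: "blinfun_apply (Blinfun \<phi>) = \<phi>"
    by (rule bounded_linear_Blinfun_apply)
  show thesis
  proof (rule that[OF apply_\<phi>])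
    show "norm (Blinfun \<phi> - canonical_embedding a) \<le> t" if "a \<in> A" for a
      using le[OF that] assms(3)
      by (intro norm_blinfun_bound) (auto simp: blinfun.diff_left apply_\<phi>)
  qed
qed

text \<open>The infimum defining the Chebyshev radius \<open>r\<close> is attained in the bidual: the sets of centres for radii
\<open>t > r\<close> are compact and decrease with \<open>t\<close>, and each contains evaluations at points of the space.\<close>

lemma bidual_centers_Chebyshev_radius_nonempty:
  assumes "A \<noteq> {}" "bounded A"
  shows "bidual_centers A (Chebyshev_radius A) \<noteq> {}"
proof -
  define r where "r = Chebyshev_radius A"
  have nonempty: "bidual_centers A t \<noteq> {}" if "t > r" for t
  proof -
    have "bdd_below (range (farthest_distance A))"
      using farthest_distance_nonneg[OF assms] by (auto intro!: bdd_belowI2)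
    then have "\<exists>x. farthest_distance A x < t"
      using that cINF_less_iff[of UNIV "farthest_distance A" t]
      by (auto simp: r_def Chebyshev_radius_def)
    then obtain x where "farthest_distance A x < t" by blast
    then have "\<forall>a\<in>A. norm (x - a) \<le> t"
      using farthest_distance_le_iff[OF assms, of x t] by simp
    then show ?thesis
      using evaluation_in_bidual_centers[of A x t] by blast
  qed
  have "bidual_centers A (r + 1) \<inter> (\<Inter>t\<in>{r<..}. bidual_centers A t) \<noteq> {}"
  proof (rule compact_imp_fip_image[OF compact_bidual_centers[OF assms(1)] closed_bidual_centers])
    fix T assume T: "finite T" "T \<subseteq> {r<..}"
    define m where "m = Min (insert (r + 1) T)"
    have "m > r" "m \<le> r + 1" "\<And>t. t \<in> T \<Longrightarrow> m \<le> t"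
      using T by (auto simp: m_def)
    then have "bidual_centers A m \<subseteq> bidual_centers A (r + 1) \<inter> (\<Inter>t\<in>T. bidual_centers A t)"
      using bidual_centers_mono by blast
    then show "bidual_centers A (r + 1) \<inter> (\<Inter>t\<in>T. bidual_centers A t) \<noteq> {}"
      using nonempty[OF \<open>m > r\<close>] by blast
  qed
  then obtain \<phi> where \<phi>: "\<And>t. t > r \<Longrightarrow> \<phi> \<in> bidual_centers A t"
    by blast
  \<comment> \<open>A common centre for all radii \<open>t > r\<close> is a centre for the radius \<open>r\<close>: let \<open>t\<close> tend to \<open>r\<close>.\<close>
  have "\<bar>\<phi> f - blinfun_apply f a\<bar> \<le> r * norm f" if "a \<in> A" for a f
  proof (rule tendsto_lowerbound)
    show "((\<lambda>t. t * norm f) \<longlongrightarrow> r * norm f) (at_right r)"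
      by (intro tendsto_intros)
    show "\<forall>\<^sub>F t in at_right r. \<bar>\<phi> f - blinfun_apply f a\<bar> \<le> t * norm f"
      using \<phi> that by (auto simp: bidual_centers_def eventually_at_filter)
  qed simp
  moreover have "linear \<phi>"
    using \<phi>[of "r + 1"] by (simp add: bidual_centers_def)
  ultimately show ?thesis
    by (auto simp: bidual_centers_def r_def)
qed

lemma canonical_embedding_diff:
  "canonical_embedding (x - y) = canonical_embedding x - canonical_embedding y"
  by (rule blinfun_eqI) (simp add: blinfun.diff_left blinfun.diff_right)

lemma L_embedded_bidual_decomposition:
  fixes \<Phi> :: "('a::banach \<Rightarrow>\<^sub>L real) \<Rightarrow>\<^sub>L real"
  assumes "L_embedded TYPE('a)"
  obtains x \<xi> where "\<Phi> = canonical_embedding x + \<xi>"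
    "\<And>a. norm (\<Phi> - canonical_embedding a) = norm (x - a) + norm \<xi>"
proof -
  obtain Xs :: "(('a \<Rightarrow>\<^sub>L real) \<Rightarrow>\<^sub>L real) set"
    where decomp: "\<And>\<Phi>. \<exists>x. \<exists>\<xi>\<in>Xs. \<Phi> = canonical_embedding x + \<xi>"
      and norm: "\<And>x \<xi>. \<xi> \<in> Xs \<Longrightarrow> norm (canonical_embedding x + \<xi>) = norm x + norm \<xi>"
    using assms unfolding L_embedded_def by blast
  obtain x \<xi> where \<xi>: "\<xi> \<in> Xs" "\<Phi> = canonical_embedding x + \<xi>"
    using decomp by blast
  have "\<Phi> - canonical_embedding a = canonical_embedding (x - a) + \<xi>" for a
    using \<xi>(2) by (simp add: canonical_embedding_diff)
  then have "norm (\<Phi> - canonical_embedding a) = norm (x - a) + norm \<xi>" for a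
    using norm[OF \<xi>(1)] by simp
  with \<xi>(2) show thesis
    by (rule that)
qed

text \<open>Write an element of the bidual as \<open>x + \<xi>\<close> in the decomposition of an \<open>L\<close>-embedded space. Its distance
to \<open>a\<close> is \<open>norm (x - a) + norm \<xi>\<close>, so if it is within the Chebyshev radius of all of \<open>A\<close>, then \<open>x\<close> is
within that radius diminished by \<open>norm \<xi>\<close>. As the radius is the infimum over the space itself,
\<open>\<xi> = 0\<close>: all centres in the bidual already lie in the space.\<close>

lemma bidual_centers_L_embedded:
  fixes A :: "'a::banach set"
  assumes "L_embedded TYPE('a)" "A \<noteq> {}" "bounded A"
  shows "bidual_centers A (Chebyshev_radius A) = (\<lambda>x f. blinfun_apply f x) ` Chebyshev_centers A"
proof
  show "(\<lambda>x f. blinfun_apply f x) ` Chebyshev_centers A \<subseteq> bidual_centers A (Chebyshev_radius A)"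
    by (auto simp: Chebyshev_centers_eq[OF assms(2,3)] dist_norm norm_minus_commute
        intro!: evaluation_in_bidual_centers)
next
  show "bidual_centers A (Chebyshev_radius A) \<subseteq> (\<lambda>x f. blinfun_apply f x) ` Chebyshev_centers A"
  proof
    fix \<phi> assume "\<phi> \<in> bidual_centers A (Chebyshev_radius A)"
    then obtain \<Phi> where \<Phi>: "blinfun_apply \<Phi> = \<phi>"
      "\<And>a. a \<in> A \<Longrightarrow> norm (\<Phi> - canonical_embedding a) \<le> Chebyshev_radius A"
      using bidual_centersE Chebyshev_radius_nonneg assms(2,3) by blast
    obtain x \<xi> where x: "\<Phi> = canonical_embedding x + \<xi>"
      "\<And>a. norm (\<Phi> - canonical_embedding a) = norm (x - a) + norm \<xi>"
      using L_embedded_bidual_decomposition[OF assms(1)] by blast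
    have "\<forall>a\<in>A. norm (x - a) \<le> Chebyshev_radius A - norm \<xi>"
      using \<Phi>(2) x(2) by (simp add: algebra_simps)
    then have le: "farthest_distance A x \<le> Chebyshev_radius A - norm \<xi>"
      by (simp add: farthest_distance_le_iff[OF assms(2,3)])
    then have "norm \<xi> \<le> 0"
      using Chebyshev_radius_le[OF assms(2,3), of x] by linarith
    then have "\<xi> = 0" by simp
    then have "\<phi> = (\<lambda>f. blinfun_apply f x)"
      using \<Phi>(1) x(1) by auto
    moreover have "x \<in> Chebyshev_centers A"
      using le \<open>\<xi> = 0\<close> Chebyshev_radius_le[OF assms(2,3)]
      by (auto simp: Chebyshev_centers_def intro: order_trans)
    ultimately show "\<phi> \<in> (\<lambda>x f. blinfun_apply f x) ` Chebyshev_centers A"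
      by blast
  qed
qed

section \<open>Fixed Chebyshev centres\<close>

theorem corollary5p4:
  fixes A :: "'a::banach set"
  assumes "L_embedded TYPE('a)"
    and "A \<noteq> {}" and "bounded A"
  shows "\<exists>x.
    (\<forall>s :: 'a \<Rightarrow> 'a.
       continuous_map weak_topology weak_topology s \<and>
       (\<forall>y z. norm (s y - s z) = norm (y - z)) \<and>
       s ` A = A \<longrightarrow> s x = x) \<and>
    (\<forall>y. (SUP a\<in>A. norm (x - a)) \<le> (SUP a\<in>A. norm (y - a)))"
proof -
  define G where "G = {s :: 'a \<Rightarrow> 'a. continuous_map weak_topology weak_topology s \<and>
    (\<forall>y z. norm (s y - s z) = norm (y - z)) \<and> s ` A = A}"
  have compact: "compactin weak_topology (Chebyshev_centers A)"
    using compact_bidual_centers[OF assms(2)]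
    by (intro compactin_weak_if_compact_evaluations)
       (simp flip: bidual_centers_L_embedded[OF assms])
  have convex: "convex (Chebyshev_centers A)"
    unfolding Chebyshev_centers_eq[OF assms(2,3)] by (intro convex_INT convex_cball)
  have nonempty: "Chebyshev_centers A \<noteq> {}"
    using bidual_centers_Chebyshev_radius_nonempty[OF assms(2,3)]
    by (simp add: bidual_centers_L_embedded[OF assms])
  have into: "g ` Chebyshev_centers A \<subseteq> Chebyshev_centers A" if "g \<in> G" for g
    using that by (intro isometry_preserves_Chebyshev_centers) (auto simp: G_def)
  have continuous: "continuous_map weak_topology weak_topology g" if "g \<in> G" for g
    using that by (simp add: G_def)
  have isometric: "dist (g y) (g z) = dist y z" if "g \<in> G" for g y z
    using that by (simp add: G_def dist_norm)
  obtain x where "x \<in> Chebyshev_centers A" "\<And>g. g \<in> G \<Longrightarrow> g x = x"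
    using nonlinear_Ryll_Nardzewski[OF compact convex nonempty continuous isometric into] by blast
  then show ?thesis
    by (auto simp: G_def Chebyshev_centers_def farthest_distance_def)
qed

end
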